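(* Beamforming is optimal to achieve any rate-tuple on the Pareto boundary of the MISO-IC: for every Pareto-optimal rate-tuple $(R_1,\ldots,R_K)$ of the region $\mathcal R$ there exist beamforming vectors $\mathbf w_k\in\mathbb C^{M_k\times1}$ with $\|\mathbf w_k\|^2\le P_k$, $k=1,\ldots,K$, such that, with $\mathbf S_k=\mathbf w_k\mathbf w_k^H$, one has $R_k=R_k(\mathbf S_1,\ldots,\mathbf S_K)$ for all $k\in\{1,\ldots,K\}$.
   Context: Setting: the $K$-user multiple-input single-output interference channel (MISO-IC) with interference treated as noise. Transmitter $k$ has $M_k\ge1$ antennas; $\mathbf h_{kj}\in\mathbb C^{M_k\times1}$ is the channel vector from transmitter $k$ to receiver $j$; $\sigma_k^2>0$ is the noise power at receiver $k$; $P_k>0$ is the power budget of transmitter $k$. $\log$ has base 2. For positive semidefinite Hermitian $\mathbf S_k\in\mathbb C^{M_k\times M_k}$ (transmit covariance matrices, of arbitrary rank), the achievable rate of user $k$ is $$R_k(\mathbf S_1,\ldots,\mathbf S_K)=\log\Big(1+\frac{\mathbf h_{kk}^H\mathbf S_k\mathbf h_{kk}}{\sum_{j\ne k}\mathbf h_{jk}^H\mathbf S_j\mathbf h_{jk}+\sigma_k^2}\Big),$$ and the achievable rate region is $$\mathcal R=\bigcup_{\{\mathbf S_k\succeq0\}:\ \mathrm{Tr}(\mathbf S_k)\le P_k,\ k=1,\ldots,K}\big\{(r_1,\ldots,r_K):0\le r_k\le R_k(\mathbf S_1,\ldots,\mathbf S_K),\ k=1,\ldots,K\big\}.$$ A rate-tuple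 $r\in\mathcal R$ is Pareto optimal if there is no $r'\in\mathcal R$ with $r'\ge r$ componentwise and $r'\ne r$; the Pareto boundary is the set of Pareto-optimal tuples. *)

theory Defs
  imports Complex_Main "Jordan_Normal_Form.Schur_Decomposition"
begin

text \<open>
  Conventions. The users are the elements of a finite type \<open>'k\<close>, so \<open>CARD('k)\<close> is the number \<open>K\<close> of
  users. The antenna numbers \<open>M k\<close> may differ from user to user, hence the dimension-carrying vectors
  and matrices. \<open>h k j\<close> is the channel from transmitter \<open>k\<close> to receiver \<open>j\<close>, \<open>N k\<close> is the noise
  power (the square of sigma) at receiver \<open>k\<close>, and \<open>P k\<close> is the power budget of transmitter \<open>k\<close>.
\<close>

text \<open>\<open>x\<^sup>H S x\<close>, which is real for Hermitian \<open>S\<close>; the real part only serves as a coercion.\<close>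

definition quad_form :: "complex mat \<Rightarrow> complex vec \<Rightarrow> real" where
  "quad_form S x = Re (conjugate x \<bullet> (S *\<^sub>v x))"

definition psd_mat :: "nat \<Rightarrow> complex mat \<Rightarrow> bool" where
  "psd_mat n S \<longleftrightarrow>
     S \<in> carrier_mat n n \<and> mat_adjoint S = S \<and> (\<forall>x \<in> carrier_vec n. 0 \<le> quad_form S x)"

definition mat_trace :: "complex mat \<Rightarrow> complex" where
  "mat_trace S = (\<Sum>i<dim_row S. S $$ (i, i))"

definition vec_sq_norm :: "complex vec \<Rightarrow> real" where
  "vec_sq_norm w = (\<Sum>i<dim_vec w. (cmod (w $ i))\<^sup>2)"

text \<open>The matrix \<open>w w\<^sup>H\<close>.\<close>

definition beam_cov :: "complex vec \<Rightarrow> complex mat" where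
  "beam_cov w = mat (dim_vec w) (dim_vec w) (\<lambda>(i, j). w $ i * cnj (w $ j))"

definition miso_rate ::
    "('k::finite \<Rightarrow> 'k \<Rightarrow> complex vec) \<Rightarrow> ('k \<Rightarrow> real) \<Rightarrow> ('k \<Rightarrow> complex mat) \<Rightarrow> 'k \<Rightarrow> real" where
  "miso_rate h N S k =
     log 2 (1 + quad_form (S k) (h k k) / ((\<Sum>j \<in> UNIV - {k}. quad_form (S j) (h j k)) + N k))"

text \<open>The trace of a Hermitian matrix is real, so the real part below is again only a coercion.\<close>

definition rate_region ::
    "('k::finite \<Rightarrow> nat) \<Rightarrow> ('k \<Rightarrow> 'k \<Rightarrow> complex vec) \<Rightarrow> ('k \<Rightarrow> real) \<Rightarrow> ('k \<Rightarrow> real) \<Rightarrow> ('k \<Rightarrow> real) set"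
  where
  "rate_region M h N P =
     (\<Union>S \<in> {S. \<forall>k. psd_mat (M k) (S k) \<and> Re (mat_trace (S k)) \<le> P k}.
        {r. \<forall>k. 0 \<le> r k \<and> r k \<le> miso_rate h N S k})"

definition pareto_boundary :: "('k \<Rightarrow> real) set \<Rightarrow> ('k \<Rightarrow> real) set" where
  "pareto_boundary R = {r \<in> R. \<not> (\<exists>r' \<in> R. (\<forall>k. r k \<le> r' k) \<and> r' \<noteq> r)}"

end

(*
  A covariance S can be replaced by the single beamformer w = S y / sqrt(y^H S y), where y is the
  direct channel (w = 0 if y^H S y = 0). It delivers exactly the same useful power:
  |y^H w|^2 = y^H S y. The Cauchy-Schwarz inequality for the semidefinite form S gives
  |x^H w|^2 <= x^H S x for every other channel x, and, applied to the unit vectors, also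
  |w|^2 <= Tr S. Hence no rate decreases, and at a Pareto-optimal tuple none can increase.
*)
theory Submission
  imports Defs
begin

lemma psd_mat_sesquilinear_cnj:
  assumes "psd_mat n S" "x \<in> carrier_vec n" "y \<in> carrier_vec n"
  shows "cnj (conjugate x \<bullet> (S *\<^sub>v y)) = conjugate y \<bullet> (S *\<^sub>v x)"
proof -
  have S: "S \<in> carrier_mat n n" and adj: "mat_adjoint S = S"
    using assms(1) by (auto simp: psd_mat_def)
  \<comment> \<open>Entrywise form of \<open>adj\<close>; it turns conjugation of the double sum
    below into transposition of the indices.\<close>
  have cnjS: "cnj (S $$ (i, j)) = S $$ (j, i)" if "i < n" "j < n" for i j
    using that S arg_cong[OF adj, of "\<lambda>A. A $$ (j, i)"]
    by (simp add: mat_adjoint_def mat_of_rows_def)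
  have "cnj (conjugate x \<bullet> (S *\<^sub>v y)) = (\<Sum>i<n. \<Sum>j<n. x $ i * (S $$ (j, i) * cnj (y $ j)))"
    using assms(2,3) S
    by (simp add: scalar_prod_def sum_distrib_left cnjS atLeast0LessThan)
  also have "\<dots> = (\<Sum>j<n. \<Sum>i<n. x $ i * (S $$ (j, i) * cnj (y $ j)))"
    by (rule sum.swap)
  also have "\<dots> = conjugate y \<bullet> (S *\<^sub>v x)"
    using assms(2,3) S
    by (simp add: scalar_prod_def sum_distrib_left atLeast0LessThan mult_ac)
  finally show ?thesis .
qed

text \<open>By Hermitian symmetry with both vectors equal, the value is its own conjugate, so
  \<open>quad_form\<close> loses nothing by taking the real part.\<close>

lemma psd_mat_sesquilinear_diag:
  assumes "psd_mat n S" "x \<in> carrier_vec n"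
  shows "conjugate x \<bullet> (S *\<^sub>v x) = of_real (quad_form S x)"
  using psd_mat_sesquilinear_cnj[OF assms(1,2,2)]
  by (simp add: quad_form_def complex_eq_iff)

text \<open>The form is nonnegative at every \<open>x + t y\<close>; its minimum over complex
  \<open>t\<close> is the claimed gap divided by \<open>quad_form S y\<close>, whence the positivity
  assumption. \<open>S\<close> may be singular.\<close>

lemma psd_mat_cauchy_schwarz:
  assumes psd: "psd_mat n S" and x: "x \<in> carrier_vec n" and y: "y \<in> carrier_vec n"
    and pos: "0 < quad_form S y"
  shows "(cmod (conjugate x \<bullet> (S *\<^sub>v y)))\<^sup>2 \<le> quad_form S x * quad_form S y"
proof -
  have S: "S \<in> carrier_mat n n"
    using psd by (simp add: psd_mat_def)
  define q where "q = quad_form S y"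
  define b where "b = conjugate x \<bullet> (S *\<^sub>v y)"
  \<comment> \<open>The minimiser over complex \<open>t\<close> of the form at
    \<open>x + t y\<close>.\<close>
  define t where "t = - cnj b / of_real q"
  define z where "z = x + t \<cdot>\<^sub>v y"
  have z: "z \<in> carrier_vec n"
    using x y by (simp add: z_def)
  have Sz: "S *\<^sub>v z = S *\<^sub>v x + t \<cdot>\<^sub>v (S *\<^sub>v y)"
    using S x y by (simp add: z_def mult_add_distrib_mat_vec[where nr = n and nc = n] mult_mat_vec)
  have cz: "conjugate z = conjugate x + cnj t \<cdot>\<^sub>v conjugate y"
    using x y by (auto simp: z_def)
  have Sx: "S *\<^sub>v x \<in> carrier_vec n" and Sy: "S *\<^sub>v y \<in> carrier_vec n"
    and cx: "conjugate x \<in> carrier_vec n" and cy: "conjugate y \<in> carrier_vec n"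
    using S x y by auto
  have "conjugate z \<bullet> (S *\<^sub>v z) =
      conjugate x \<bullet> (S *\<^sub>v x) + t * b + cnj t * (conjugate y \<bullet> (S *\<^sub>v x))
        + cnj t * t * (conjugate y \<bullet> (S *\<^sub>v y))"
    unfolding Sz cz b_def using Sx Sy cx cy
    by (simp add: add_scalar_prod_distrib[where n = n] scalar_prod_add_distrib[where n = n]
        algebra_simps)
  also have "\<dots> = of_real (quad_form S x) + t * b + cnj t * cnj b + cnj t * t * of_real q"
    using psd_mat_sesquilinear_cnj[OF psd x y] psd_mat_sesquilinear_diag[OF psd x]
      psd_mat_sesquilinear_diag[OF psd y] by (simp add: b_def q_def)
  \<comment> \<open>Each of the two cross terms contributes \<open>- b * cnj b / q\<close>, and the
    last term gives one of them back.\<close>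
  also have "\<dots> = of_real (quad_form S x) - b * cnj b / of_real q"
    using pos by (simp add: t_def q_def[symmetric] field_simps)
  also have "\<dots> = of_real (quad_form S x - (cmod b)\<^sup>2 / q)"
    using complex_norm_square[of b] by simp
  finally have "quad_form S z = quad_form S x - (cmod b)\<^sup>2 / q"
    unfolding quad_form_def[of S z] by simp
  moreover have "0 \<le> quad_form S z"
    using psd z by (simp add: psd_mat_def)
  ultimately show ?thesis
    using pos by (simp add: b_def q_def divide_le_eq)
qed

lemma conjugate_unit_vec_scalar_prod:
  assumes "v \<in> carrier_vec n" "i < n"
  shows "conjugate (unit_vec n i) \<bullet> v = (v $ i :: complex)"
proof -
  have "conjugate (unit_vec n i) = (unit_vec n i :: complex vec)"
    by (auto simp: unit_vec_def)
  then show ?thesis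
    using assms by simp
qed

lemma quad_form_unit_vec:
  assumes "S \<in> carrier_mat n n" "i < n"
  shows "quad_form S (unit_vec n i) = Re (S $$ (i, i))"
  using assms by (simp add: quad_form_def conjugate_unit_vec_scalar_prod)

text \<open>Entry \<open>i\<close> of \<open>S y\<close> is the form paired with the unit vector
  \<open>i\<close>, so Cauchy-Schwarz bounds it by the diagonal entry; summing the diagonal entries
  yields the trace.\<close>

lemma vec_sq_norm_mult_le_trace:
  assumes psd: "psd_mat n S" and y: "y \<in> carrier_vec n" and pos: "0 < quad_form S y"
  shows "vec_sq_norm (S *\<^sub>v y) \<le> Re (mat_trace S) * quad_form S y"
proof -
  have S: "S \<in> carrier_mat n n"
    using psd by (simp add: psd_mat_def)
  have "(cmod ((S *\<^sub>v y) $ i))\<^sup>2 \<le> Re (S $$ (i, i)) * quad_form S y" if i: "i < n" for i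
    using psd_mat_cauchy_schwarz[OF psd _ y pos, of "unit_vec n i"] S i y
    by (simp add: conjugate_unit_vec_scalar_prod quad_form_unit_vec)
  then show ?thesis
    using S by (auto simp: vec_sq_norm_def mat_trace_def sum_distrib_right intro!: sum_mono)
qed

lemma quad_form_beam_cov:
  assumes "w \<in> carrier_vec n" "x \<in> carrier_vec n"
  shows "quad_form (beam_cov w) x = (cmod (conjugate x \<bullet> w))\<^sup>2"
proof -
  \<comment> \<open>The summand splits into a factor in \<open>i\<close> and a factor in
    \<open>j\<close>, whose sums are conjugate to each other.\<close>
  have "conjugate x \<bullet> (beam_cov w *\<^sub>v x) =
      (\<Sum>i<n. \<Sum>j<n. (cnj (x $ i) * w $ i) * (x $ j * cnj (w $ j)))"
    using assms
    by (simp add: beam_cov_def scalar_prod_def sum_distrib_left atLeast0LessThan mult_ac)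
  also have "\<dots> = (conjugate x \<bullet> w) * cnj (conjugate x \<bullet> w)"
    using assms by (simp add: scalar_prod_def sum_product atLeast0LessThan)
  finally show ?thesis
    by (simp add: quad_form_def complex_norm_square[symmetric])
qed

lemma mat_trace_beam_cov: "Re (mat_trace (beam_cov w)) = vec_sq_norm w"
  by (simp add: mat_trace_def beam_cov_def vec_sq_norm_def complex_norm_square[symmetric])

lemma psd_mat_beam_cov:
  assumes "w \<in> carrier_vec n"
  shows "psd_mat n (beam_cov w)"
proof -
  have "mat_adjoint (beam_cov w) = beam_cov w"
    by (rule eq_matI) (auto simp: mat_adjoint_def mat_of_rows_def beam_cov_def)
  then show ?thesis
    using assms quad_form_beam_cov[OF assms] by (auto simp: psd_mat_def beam_cov_def)
qed

text \<open>The last bound is uniform in \<open>x\<close>, so a single \<open>w\<close> limits the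
  interference at all unintended receivers at once.\<close>

lemma beamforming_dominates:
  assumes psd: "psd_mat n S" and y: "y \<in> carrier_vec n"
  obtains w where "w \<in> carrier_vec n" "vec_sq_norm w \<le> Re (mat_trace S)"
    "quad_form (beam_cov w) y = quad_form S y"
    "\<And>x. x \<in> carrier_vec n \<Longrightarrow> quad_form (beam_cov w) x \<le> quad_form S x"
proof (cases "quad_form S y = 0")
  case True
  have S: "S \<in> carrier_mat n n" and nonneg: "\<And>x. x \<in> carrier_vec n \<Longrightarrow> 0 \<le> quad_form S x"
    using psd by (auto simp: psd_mat_def)
  \<comment> \<open>The zero beamformer serves here; its power bound needs a nonnegative trace, and
    the diagonal entries are values of the form at unit vectors.\<close>
  have "0 \<le> Re (mat_trace S)"
    using S nonneg by (auto simp: mat_trace_def quad_form_unit_vec[OF S, symmetric] intro!: sum_nonneg)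
  then show ?thesis
    using that[of "0\<^sub>v n"] True nonneg y quad_form_beam_cov[of "0\<^sub>v n" n]
    by (simp add: vec_sq_norm_def)
next
  case False
  have S: "S \<in> carrier_mat n n"
    using psd by (simp add: psd_mat_def)
  define q where "q = quad_form S y"
  have pos: "0 < q"
    using False psd y by (simp add: q_def psd_mat_def order.strict_iff_order)
  define w where "w = of_real (1 / sqrt q) \<cdot>\<^sub>v (S *\<^sub>v y)"
  have w: "w \<in> carrier_vec n"
    using S y by (simp add: w_def)
  have form: "quad_form (beam_cov w) x = (cmod (conjugate x \<bullet> (S *\<^sub>v y)))\<^sup>2 / q"
    if "x \<in> carrier_vec n" for x
    using that S y pos quad_form_beam_cov[OF w that]
    by (simp add: w_def norm_mult norm_divide power_mult_distrib power_divide)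
  show ?thesis
  proof (rule that[OF w])
    have "vec_sq_norm w = vec_sq_norm (S *\<^sub>v y) / q"
      using S y pos
      by (simp add: w_def vec_sq_norm_def norm_mult norm_divide power_mult_distrib power_divide
          sum_divide_distrib)
    then show "vec_sq_norm w \<le> Re (mat_trace S)"
      using vec_sq_norm_mult_le_trace[OF psd y] pos by (simp add: q_def divide_le_eq)
    \<comment> \<open>At \<open>x = y\<close> the numerator in \<open>form\<close> is the square of
      \<open>q\<close>, which leaves \<open>q\<close>.\<close>
    show "quad_form (beam_cov w) y = quad_form S y"
      using form[OF y] psd_mat_sesquilinear_diag[OF psd y] pos
      by (simp add: q_def power2_eq_square)
    show "quad_form (beam_cov w) x \<le> quad_form S x" if "x \<in> carrier_vec n" for x
      using form[OF that] psd_mat_cauchy_schwarz[OF psd that y] pos by (simp add: q_def divide_le_eq)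
  qed
qed

lemma miso_rate_mono:
  assumes "N k > 0" "0 \<le> quad_form (S k) (h k k)"
    and "quad_form (S k) (h k k) \<le> quad_form (T k) (h k k)"
    and "\<And>j. 0 \<le> quad_form (T j) (h j k)"
    and "\<And>j. j \<noteq> k \<Longrightarrow> quad_form (T j) (h j k) \<le> quad_form (S j) (h j k)"
  shows "miso_rate h N S k \<le> miso_rate h N T k"
proof -
  let ?I = "\<lambda>S. (\<Sum>j \<in> UNIV - {k}. quad_form (S j) (h j k)) + N k"
  have "0 < ?I T"
    using assms(1,4) by (simp add: add_nonneg_pos sum_nonneg)
  moreover have "?I T \<le> ?I S"
    using assms(5) by (auto intro: sum_mono)
  \<comment> \<open>The second fact keeps the smaller argument of the logarithm positive.\<close>
  ultimately have "quad_form (S k) (h k k) / ?I S \<le> quad_form (T k) (h k k) / ?I T"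
    "0 \<le> quad_form (S k) (h k k) / ?I S"
    using assms(2,3) by (auto intro!: frac_le divide_nonneg_pos)
  then show ?thesis
    unfolding miso_rate_def by (intro log_mono) auto
qed

theorem mainTheorem3:
  fixes M :: "'k::finite \<Rightarrow> nat"
    and h :: "'k \<Rightarrow> 'k \<Rightarrow> complex vec"
    and N P :: "'k \<Rightarrow> real"
    and r :: "'k \<Rightarrow> real"
  assumes "\<And>k. M k \<ge> 1"
    and "\<And>k j. h k j \<in> carrier_vec (M k)"
    and "\<And>k. N k > 0"
    and "\<And>k. P k > 0"
    and "r \<in> pareto_boundary (rate_region M h N P)"
  shows "\<exists>w :: 'k \<Rightarrow> complex vec.
           (\<forall>k. w k \<in> carrier_vec (M k) \<and> vec_sq_norm (w k) \<le> P k) \<and>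
           (\<forall>k. r k = miso_rate h N (\<lambda>j. beam_cov (w j)) k)"
proof -
  have "r \<in> rate_region M h N P"
    and maximal: "\<And>r'. r' \<in> rate_region M h N P \<Longrightarrow> (\<And>k. r k \<le> r' k) \<Longrightarrow> r' = r"
    using assms(5) by (auto simp: pareto_boundary_def)
  then obtain S where S: "\<And>k. psd_mat (M k) (S k)" "\<And>k. Re (mat_trace (S k)) \<le> P k"
    and r: "\<And>k. 0 \<le> r k" "\<And>k. r k \<le> miso_rate h N S k"
    by (auto simp: rate_region_def)
  have "\<exists>w. w \<in> carrier_vec (M k) \<and> vec_sq_norm w \<le> Re (mat_trace (S k)) \<and>
      quad_form (beam_cov w) (h k k) = quad_form (S k) (h k k) \<and>
      (\<forall>x \<in> carrier_vec (M k). quad_form (beam_cov w) x \<le> quad_form (S k) x)" for k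
    by (rule beamforming_dominates[OF S(1) assms(2), of k k]) blast
  then obtain w where w: "\<And>k. w k \<in> carrier_vec (M k)"
    "\<And>k. vec_sq_norm (w k) \<le> Re (mat_trace (S k))"
    "\<And>k. quad_form (beam_cov (w k)) (h k k) = quad_form (S k) (h k k)"
    "\<And>k x. x \<in> carrier_vec (M k) \<Longrightarrow> quad_form (beam_cov (w k)) x \<le> quad_form (S k) x"
    by metis
  define r' where "r' = miso_rate h N (\<lambda>j. beam_cov (w j))"
  have power: "vec_sq_norm (w k) \<le> P k" for k
    using w(2) S(2) order_trans by blast
  have "miso_rate h N S k \<le> r' k" for k
    unfolding r'_def using assms(2,3) S(1) w psd_mat_beam_cov[OF w(1)]
    by (intro miso_rate_mono) (auto simp: psd_mat_def)
  then have le: "r k \<le> r' k" for k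
    using r(2) order_trans by blast
  \<comment> \<open>The rank-one covariances are the witness: their traces are the beam powers, and
    nonnegativity of \<open>r'\<close> is inherited from \<open>r\<close>.\<close>
  have "r' \<in> rate_region M h N P"
    using psd_mat_beam_cov[OF w(1)] power order_trans[OF r(1) le]
    by (auto simp: rate_region_def mat_trace_beam_cov r'_def intro!: exI[of _ "\<lambda>j. beam_cov (w j)"])
  then have "r' = r"
    using le by (rule maximal)
  then show ?thesis
    using w(1) power by (auto simp: r'_def)
qed

end
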